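(* Let $m\ge 2$, $n\ge 1$ and $\mathcal{A}\in T_{m,n}$. Then the following conditions are equivalent: (1) $\mathcal{A}$ is a $B$-tensor. (2) $\mathcal{A}=\mathcal{B}+\mathcal{C}$ for some $\mathcal{B},\mathcal{C}\in T_{m,n}$, where $\mathcal{B}$ is both a $Z$-tensor and a $B$-tensor, and $\mathcal{C}$ is a nonnegative $B$-tensor (i.e. a $B$-tensor all of whose entries are nonnegative).
   Context: $[n]=\{1,\dots,n\}$. $T_{m,n}$ is the set of real $m$th order $n$-dimensional tensors $\mathcal{A}=(a_{i_1\cdots i_m})$, with real entries $a_{i_1\cdots i_m}$, $i_1,\dots,i_m\in[n]$; addition is entrywise. A tensor $\mathcal{A}=(a_{i_1\cdots i_m})\in T_{m,n}$ is a $B$-tensor if for all $i\in[n]$, $\sum_{i_2,\dots,i_m=1}^n a_{ii_2\cdots i_m}>0$ and $\frac{1}{n^{m-1}}\sum_{i_2,\dots,i_m=1}^n a_{ii_2\cdots i_m}>a_{ij_2\cdots j_m}$ for all $(j_2,\dots,j_m)\ne(i,\dots,i)$. $\mathcal{A}$ is a $Z$-tensor if all its off-diagonal entries are non-positive, i.e. $a_{ii_2\cdots i_m}\le 0$ for all $i\in[n]$ and $(i_2,\dots,i_m)\neq(i,\dots,i)$. *)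

theory Defs
  imports Complex_Main "HOL-Library.Function_Algebras"
begin

text \<open>
  Multi-indices are lists over \<open>{1..n}\<close>. A tensor of order \<open>m\<close> and dimension \<open>n\<close> is a real
  function on lists which is zero off the multi-indices of length \<open>m\<close>, so that equality of tensors
  is equality of functions and entrywise addition is the pointwise \<open>+\<close> of
  \<^theory>\<open>HOL-Library.Function_Algebras\<close>.
\<close>

definition multi_indices :: "nat \<Rightarrow> nat \<Rightarrow> nat list set" where
  "multi_indices k n = {js. length js = k \<and> set js \<subseteq> {1..n}}"

definition tensors :: "nat \<Rightarrow> nat \<Rightarrow> (nat list \<Rightarrow> real) set" where
  "tensors m n = {A. \<forall>is. is \<notin> multi_indices m n \<longrightarrow> A is = 0}"

text \<open>
  The entry $a_{i j_2 \cdots j_m}$ is \<open>A (i # js)\<close> with \<open>js = [j\<^sub>2, \<dots>, j\<^sub>m]\<close>; it is diagonal iff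
  \<open>js = replicate (m - 1) i\<close>. The following predicates are meant for \<open>m \<ge> 2\<close>.
\<close>

definition B_tensor :: "nat \<Rightarrow> nat \<Rightarrow> (nat list \<Rightarrow> real) \<Rightarrow> bool" where
  "B_tensor m n A \<longleftrightarrow> A \<in> tensors m n \<and>
     (\<forall>i\<in>{1..n}.
        (\<Sum>js\<in>multi_indices (m - 1) n. A (i # js)) > 0 \<and>
        (\<forall>js\<in>multi_indices (m - 1) n. js \<noteq> replicate (m - 1) i \<longrightarrow>
           1 / real n ^ (m - 1) * (\<Sum>ks\<in>multi_indices (m - 1) n. A (i # ks)) > A (i # js)))"

definition Z_tensor :: "nat \<Rightarrow> nat \<Rightarrow> (nat list \<Rightarrow> real) \<Rightarrow> bool" where
  "Z_tensor m n A \<longleftrightarrow> A \<in> tensors m n \<and>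
     (\<forall>i\<in>{1..n}. \<forall>js\<in>multi_indices (m - 1) n. js \<noteq> replicate (m - 1) i \<longrightarrow> A (i # js) \<le> 0)"

definition nonneg_tensor :: "nat \<Rightarrow> nat \<Rightarrow> (nat list \<Rightarrow> real) \<Rightarrow> bool" where
  "nonneg_tensor m n A \<longleftrightarrow> A \<in> tensors m n \<and> (\<forall>is\<in>multi_indices m n. A is \<ge> 0)"

end

theory Submission imports Defs begin

text \<open>
  Let row \<open>i\<close> have \<open>N = n^(m-1)\<close> entries and sum \<open>S\<close>, and let \<open>r \<ge> 0\<close> be the maximum of \<open>0\<close> and
  its off-diagonal entries, so that \<open>\<delta> = (S - N r) / 2\<close> is positive. Row \<open>i\<close> of \<open>C\<close> is constantly
  \<open>r\<close>, with \<open>\<delta>\<close> added on the diagonal to push the mean strictly above \<open>r\<close>. Then \<open>B = A - C\<close> has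
  nonpositive off-diagonal entries, and its row sum is still \<open>S - N r - \<delta> = \<delta> > 0\<close>. Conversely, the
  \<open>B\<close>-tensors are closed under addition because the defining inequalities are linear.
\<close>

lemma finite_multi_indices: "finite (multi_indices k n)"
  unfolding multi_indices_def using finite_lists_length_eq[of "{1..n}" k]
  by (simp add: conj_commute)

lemma card_multi_indices: "card (multi_indices k n) = n ^ k"
  unfolding multi_indices_def using card_lists_length_eq[of "{1..n}" k]
  by (simp add: conj_commute)

lemma Cons_in_multi_indices:
  "i # js \<in> multi_indices (Suc k) n \<longleftrightarrow> i \<in> {1..n} \<and> js \<in> multi_indices k n"
  by (auto simp: multi_indices_def)

lemma replicate_in_multi_indices: "i \<in> {1..n} \<Longrightarrow> replicate k i \<in> multi_indices k n"
  by (auto simp: multi_indices_def)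

lemma tensors_add: "A \<in> tensors m n \<Longrightarrow> B \<in> tensors m n \<Longrightarrow> A + B \<in> tensors m n"
  by (simp add: tensors_def)

lemma tensors_diff: "A \<in> tensors m n \<Longrightarrow> B \<in> tensors m n \<Longrightarrow> A - B \<in> tensors m n"
  by (simp add: tensors_def)

lemma B_tensor_add:
  assumes "B_tensor m n A" and "B_tensor m n B"
  shows "B_tensor m n (A + B)"
  using assms unfolding B_tensor_def
  by (auto simp: tensors_add sum.distrib distrib_left intro: add_strict_mono add_pos_pos)

text \<open>A positive row sum makes the row mean positive, hence larger than any nonpositive
  off-diagonal entry. For \<open>A - C\<close> this reduces the \<open>B\<close>-tensor property to
  a computation of row sums.\<close>

lemma Z_tensor_imp_B_tensor:
  assumes "Z_tensor m n A" and "n \<ge> 1"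
    and pos: "\<And>i. i \<in> {1..n} \<Longrightarrow> (\<Sum>js\<in>multi_indices (m - 1) n. A (i # js)) > 0"
  shows "B_tensor m n A"
  unfolding B_tensor_def
proof (intro conjI ballI impI)
  show "A \<in> tensors m n"
    using assms(1) by (simp add: Z_tensor_def)
next
  fix i js
  assume i: "i \<in> {1..n}" and "js \<in> multi_indices (m - 1) n" "js \<noteq> replicate (m - 1) i"
  then have "A (i # js) \<le> 0"
    using assms(1) by (simp add: Z_tensor_def)
  also have "0 < 1 / real n ^ (m - 1) * (\<Sum>ks\<in>multi_indices (m - 1) n. A (i # ks))"
    using pos[OF i] \<open>n \<ge> 1\<close> by simp
  finally show "A (i # js) < 1 / real n ^ (m - 1) * (\<Sum>ks\<in>multi_indices (m - 1) n. A (i # ks))" .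
qed (rule pos)

text \<open>Both 0 and every off-diagonal entry lie strictly below the row mean, and a maximum of
  finitely many such values is attained, so it stays strictly below the mean.\<close>

lemma B_tensor_row_bound:
  assumes B: "B_tensor m n A" and n: "n \<ge> 1" and i: "i \<in> {1..n}"
  obtains r where "r \<ge> 0"
    and "\<And>js. js \<in> multi_indices (m - 1) n \<Longrightarrow> js \<noteq> replicate (m - 1) i \<Longrightarrow> A (i # js) \<le> r"
    and "real n ^ (m - 1) * r < (\<Sum>js\<in>multi_indices (m - 1) n. A (i # js))"
proof -
  let ?J = "multi_indices (m - 1) n - {replicate (m - 1) i}"
  \<comment> \<open>Inserting 0 gives \<open>Max R \<ge> 0\<close> and keeps \<open>R\<close>
    nonempty when \<open>n = 1\<close>, where the row has no off-diagonal entry.\<close>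
  define R where "R = insert 0 ((\<lambda>js. A (i # js)) ` ?J)"
  have fin: "finite R"
    by (simp add: R_def finite_multi_indices)
  have "Max R \<in> R"
    using fin by (rule Max_in) (simp add: R_def)
  \<comment> \<open>For \<open>x = 0\<close> this is positivity of the row sum; for an off-diagonal
    entry it is the mean condition multiplied by \<open>n ^ (m - 1)\<close>.\<close>
  moreover have "real n ^ (m - 1) * x < (\<Sum>js\<in>multi_indices (m - 1) n. A (i # js))" if "x \<in> R" for x
    using that B n i by (auto simp: R_def B_tensor_def field_simps)
  ultimately have "real n ^ (m - 1) * Max R < (\<Sum>js\<in>multi_indices (m - 1) n. A (i # js))"
    by blast
  moreover have "Max R \<ge> 0"
    using fin by (rule Max_ge) (simp add: R_def)
  moreover have "A (i # js) \<le> Max R"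
    if "js \<in> multi_indices (m - 1) n" "js \<noteq> replicate (m - 1) i" for js
    using fin by (rule Max_ge) (use that in \<open>simp add: R_def\<close>)
  ultimately show thesis
    using that by blast
qed

text \<open>The shape of the summand \<open>C\<close>. The parameter \<open>d\<close> is the
  increment on the diagonal, not the diagonal entry itself; the outer conditional secures membership
  in \<open>tensors m n\<close>.\<close>

definition row_tensor :: "nat \<Rightarrow> nat \<Rightarrow> (nat \<Rightarrow> real) \<Rightarrow> (nat \<Rightarrow> real) \<Rightarrow> nat list \<Rightarrow> real" where
  "row_tensor m n r d is =
     (if is \<in> multi_indices m n
      then r (hd is) + (if tl is = replicate (m - 1) (hd is) then d (hd is) else 0) else 0)"

lemma row_tensor_in_tensors: "row_tensor m n r d \<in> tensors m n"
  by (simp add: tensors_def row_tensor_def)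

lemma row_tensor_Cons:
  assumes "m \<ge> 1" and "i \<in> {1..n}" and "js \<in> multi_indices (m - 1) n"
  shows "row_tensor m n r d (i # js) = r i + (if js = replicate (m - 1) i then d i else 0)"
  using assms Cons_in_multi_indices[of i js "m - 1" n] by (simp add: row_tensor_def)

lemma sum_row_tensor:
  assumes "m \<ge> 1" and "i \<in> {1..n}"
  shows "(\<Sum>js\<in>multi_indices (m - 1) n. row_tensor m n r d (i # js)) = real n ^ (m - 1) * r i + d i"
  using replicate_in_multi_indices[OF assms(2), of "m - 1"]
  by (simp add: row_tensor_Cons[OF assms] sum.distrib card_multi_indices finite_multi_indices)

lemma nonneg_row_tensor:
  assumes "m \<ge> 1" and "\<And>i. i \<in> {1..n} \<Longrightarrow> r i \<ge> 0" and "\<And>i. i \<in> {1..n} \<Longrightarrow> d i \<ge> 0"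
  shows "nonneg_tensor m n (row_tensor m n r d)"
  unfolding nonneg_tensor_def
proof (intro conjI ballI row_tensor_in_tensors)
  fix js assume js: "js \<in> multi_indices m n"
  \<comment> \<open>A positive order excludes the empty list, whose \<open>hd\<close> is
    unspecified.\<close>
  with \<open>m \<ge> 1\<close> have "hd js \<in> {1..n}"
    by (cases js) (auto simp: multi_indices_def)
  with js assms(2,3) show "row_tensor m n r d js \<ge> 0"
    by (simp add: row_tensor_def)
qed

text \<open>The mean of row \<open>i\<close> is \<open>r i + d i / n ^ (m - 1)\<close>, which
  exceeds the common off-diagonal value \<open>r i\<close> exactly because \<open>d i\<close> is
  positive.\<close>

lemma B_row_tensor:
  assumes "m \<ge> 1" and "n \<ge> 1"
    and "\<And>i. i \<in> {1..n} \<Longrightarrow> r i \<ge> 0" and "\<And>i. i \<in> {1..n} \<Longrightarrow> d i > 0"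
  shows "B_tensor m n (row_tensor m n r d)"
  unfolding B_tensor_def
proof (intro conjI ballI impI row_tensor_in_tensors)
  fix i assume i: "i \<in> {1..n}"
  show "0 < (\<Sum>js\<in>multi_indices (m - 1) n. row_tensor m n r d (i # js))"
    unfolding sum_row_tensor[OF \<open>m \<ge> 1\<close> i] using assms(3,4)[OF i] by (simp add: add_nonneg_pos)
  fix js assume "js \<in> multi_indices (m - 1) n" "js \<noteq> replicate (m - 1) i"
  then show "row_tensor m n r d (i # js) <
      1 / real n ^ (m - 1) * (\<Sum>ks\<in>multi_indices (m - 1) n. row_tensor m n r d (i # ks))"
    unfolding sum_row_tensor[OF \<open>m \<ge> 1\<close> i]
    using assms(4)[OF i] \<open>n \<ge> 1\<close> by (simp add: row_tensor_Cons[OF \<open>m \<ge> 1\<close> i] field_simps)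
qed

theorem theorem3:
  fixes m n :: nat and A :: "nat list \<Rightarrow> real"
  assumes "m \<ge> 2" and "n \<ge> 1" and "A \<in> tensors m n"
  shows "B_tensor m n A \<longleftrightarrow>
    (\<exists>B\<in>tensors m n. \<exists>C\<in>tensors m n.
       A = B + C \<and>
       Z_tensor m n B \<and> B_tensor m n B \<and>
       nonneg_tensor m n C \<and> B_tensor m n C)"
proof
  assume A: "B_tensor m n A"
  have m: "m \<ge> 1"
    using \<open>m \<ge> 2\<close> by simp
  define S where "S i = (\<Sum>js\<in>multi_indices (m - 1) n. A (i # js))" for i
  have "\<forall>i\<in>{1..n}. \<exists>r\<ge>0. real n ^ (m - 1) * r < S i \<and>
      (\<forall>js\<in>multi_indices (m - 1) n. js \<noteq> replicate (m - 1) i \<longrightarrow> A (i # js) \<le> r)"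
    unfolding S_def using B_tensor_row_bound[OF A \<open>n \<ge> 1\<close>] by metis
  then obtain r where r: "\<And>i. i \<in> {1..n} \<Longrightarrow> r i \<ge> 0"
      "\<And>i. i \<in> {1..n} \<Longrightarrow> real n ^ (m - 1) * r i < S i"
      "\<And>i js. i \<in> {1..n} \<Longrightarrow> js \<in> multi_indices (m - 1) n \<Longrightarrow> js \<noteq> replicate (m - 1) i \<Longrightarrow>
        A (i # js) \<le> r i"
    by metis
  \<comment> \<open>The excess of the row sum over \<open>n ^ (m - 1) * r i\<close> is shared
    equally: one half raises the diagonal of \<open>C\<close>, the other remains as the row sum of
    \<open>A - C\<close>.\<close>
  define d where "d i = (S i - real n ^ (m - 1) * r i) / 2" for i
  have d: "d i > 0" if "i \<in> {1..n}" for i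
    using r(2)[OF that] by (simp add: d_def)
  define C where "C = row_tensor m n r d"
  have C: "C \<in> tensors m n" "nonneg_tensor m n C" "B_tensor m n C"
    unfolding C_def
    by (blast intro: row_tensor_in_tensors nonneg_row_tensor B_row_tensor m assms(2) r(1) d less_imp_le)+
  have AC: "A - C \<in> tensors m n"
    using assms(3) C(1) by (rule tensors_diff)
  \<comment> \<open>Off the diagonal \<open>C\<close> takes the value \<open>r i\<close>, which
    bounds the corresponding entries of \<open>A\<close> from above.\<close>
  then have Z: "Z_tensor m n (A - C)"
    unfolding Z_tensor_def using r(3) by (simp add: C_def row_tensor_Cons[OF m])
  have "(\<Sum>js\<in>multi_indices (m - 1) n. (A - C) (i # js)) = d i" if "i \<in> {1..n}" for i
  proof -
    have "(\<Sum>js\<in>multi_indices (m - 1) n. (A - C) (i # js)) = S i - (real n ^ (m - 1) * r i + d i)"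
      by (simp add: S_def C_def sum_subtractf sum_row_tensor[OF m that, simplified])
    also have "\<dots> = d i"
      by (simp add: d_def field_simps)
    finally show ?thesis .
  qed
  then have "B_tensor m n (A - C)"
    using Z_tensor_imp_B_tensor[OF Z \<open>n \<ge> 1\<close>] d by simp
  moreover have "A = (A - C) + C"
    by simp
  ultimately show "\<exists>B\<in>tensors m n. \<exists>C\<in>tensors m n. A = B + C \<and>
      Z_tensor m n B \<and> B_tensor m n B \<and> nonneg_tensor m n C \<and> B_tensor m n C"
    using AC Z C by blast
next
  assume "\<exists>B\<in>tensors m n. \<exists>C\<in>tensors m n. A = B + C \<and>
      Z_tensor m n B \<and> B_tensor m n B \<and> nonneg_tensor m n C \<and> B_tensor m n C"
  then show "B_tensor m n A"
    using B_tensor_add by blast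
qed

end
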